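(* For all integers $n\geq k\geq 1$ there exists a non-zero sum Heffter array $\mathrm{NH}(n;k)$.
   Context: A partially filled (p.f.) array on a set $\Omega$ is a matrix whose cells are either empty or contain an element of $\Omega$. For integers $n\ge k\ge 1$, a (square) non-zero sum Heffter array $\mathrm{NH}(n;k)$ is an $n\times n$ p.f. array $A$ with entries in $\mathbb{Z}_{2nk+1}$ such that: (a) each row and each column contains exactly $k$ filled cells; (b) the multiset $\{\pm x \mid x\in A\}$ (two elements $x,-x$ for each filled cell with entry $x$) contains each element of $\mathbb{Z}_{2nk+1}\setminus\{0\}$ exactly once; (c) the sum of the elements in every row and in every column is different from $0$ in $\mathbb{Z}_{2nk+1}$. *)

theory Defs
  imports "HOL-Number_Theory.Residues" "HOL-Library.Multiset"
begin

text \<open>Rows and columns are numbered from 0; \<open>None\<close> is an empty cell. Positions outside the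
  \<open>m \<times> n\<close> rectangle are required to be \<open>None\<close>.\<close>

type_synonym 'a pf_array = "nat \<Rightarrow> nat \<Rightarrow> 'a option"

definition pf_array :: "nat \<Rightarrow> nat \<Rightarrow> 'a set \<Rightarrow> 'a pf_array \<Rightarrow> bool" where
  "pf_array m n \<Omega> A \<longleftrightarrow> (\<forall>i j x. A i j = Some x \<longrightarrow> i < m \<and> j < n \<and> x \<in> \<Omega>)"

definition row_support :: "'a pf_array \<Rightarrow> nat \<Rightarrow> nat set" where
  "row_support A i = {j. A i j \<noteq> None}"

definition col_support :: "'a pf_array \<Rightarrow> nat \<Rightarrow> nat set" where
  "col_support A j = {i. A i j \<noteq> None}"

definition filled_cells :: "'a pf_array \<Rightarrow> (nat \<times> nat) set" where
  "filled_cells A = {(i, j). A i j \<noteq> None}"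

definition row_sum :: "('a, 'b) ring_scheme \<Rightarrow> 'a pf_array \<Rightarrow> nat \<Rightarrow> 'a" where
  "row_sum R A i = (\<Oplus>\<^bsub>R\<^esub>j \<in> row_support A i. the (A i j))"

definition col_sum :: "('a, 'b) ring_scheme \<Rightarrow> 'a pf_array \<Rightarrow> nat \<Rightarrow> 'a" where
  "col_sum R A j = (\<Oplus>\<^bsub>R\<^esub>i \<in> col_support A j. the (A i j))"

text \<open>The multiset \<open>{\<plusminus>x | x \<in> A}\<close>, with two elements for each filled cell.\<close>

definition pm_mset :: "('a, 'b) ring_scheme \<Rightarrow> 'a pf_array \<Rightarrow> 'a multiset" where
  "pm_mset R A = (\<Sum>(i, j) \<in> filled_cells A. {# the (A i j), \<ominus>\<^bsub>R\<^esub> the (A i j) #})"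

text \<open>The ring of integers modulo \<open>v\<close>, with carrier \<open>{0..v - 1}\<close>.\<close>

abbreviation Z_mod :: "nat \<Rightarrow> int ring" where
  "Z_mod v \<equiv> residue_ring (int v)"

definition nonzero_sum_Heffter :: "nat \<Rightarrow> nat \<Rightarrow> int pf_array \<Rightarrow> bool" where
  "nonzero_sum_Heffter n k A \<longleftrightarrow>
     (let R = Z_mod (2 * n * k + 1) in
        pf_array n n (carrier R) A \<and>
        (\<forall>i<n. card (row_support A i) = k) \<and>
        (\<forall>j<n. card (col_support A j) = k) \<and>
        (\<forall>x \<in> carrier R - {\<zero>\<^bsub>R\<^esub>}. count (pm_mset R A) x = 1) \<and>
        (\<forall>i<n. row_sum R A i \<noteq> \<zero>\<^bsub>R\<^esub>) \<and>
        (\<forall>j<n. col_sum R A j \<noteq> \<zero>\<^bsub>R\<^esub>))"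

end

theory Submission
  imports Defs "HOL-Combinatorics.Transposition"
begin

text \<open>Place the numbers \<open>1, \<dots>, nk\<close> arbitrarily in the \<open>nk\<close> cells and then move them and
  change their signs so as to minimise the number of lines whose sum vanishes modulo
  \<open>v = 2nk + 1\<close>. Suppose that row \<open>r\<close> has sum zero. Entries are nonzero, so it has two cells. Negating its entry
  \<open>x\<close> in column \<open>c\<close> repairs row \<open>r\<close>, and spoils column \<open>c\<close> only if that column has sum \<open>2x\<close>. If
  this happens for every cell of row \<open>r\<close>, take two of its columns \<open>c\<close>, \<open>d\<close>, with entries \<open>x\<close>,
  \<open>y\<close>, and replace these entries by \<open>-y\<close>, \<open>x\<close>: row \<open>r\<close> gets the sum \<open>-2y\<close>, column \<open>c\<close> the sum
  \<open>x - y\<close> and column \<open>d\<close> the sum \<open>x + y\<close>, all nonzero. So the minimum is zero.\<close>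

section \<open>Signed labellings without zero-sum lines\<close>

text \<open>Only rows are treated. The columns of \<open>C\<close> are the rows of
  \<open>C\<inverse>\<close> under \<open>f \<circ> prod.swap\<close>, so facts about lines are
  proved once.\<close>

definition line_sum :: "('a \<times> 'b) set \<Rightarrow> ('a \<times> 'b \<Rightarrow> int) \<Rightarrow> 'a \<Rightarrow> int" where
  "line_sum C f i = (\<Sum>j \<in> C `` {i}. f (i, j))"

text \<open>The restriction to \<open>Domain C\<close> leaves out lines without cells, whose empty
  sum every \<open>v\<close> divides.\<close>

definition zero_lines :: "int \<Rightarrow> ('a \<times> 'b) set \<Rightarrow> ('a \<times> 'b \<Rightarrow> int) \<Rightarrow> 'a set" where
  "zero_lines v C f = {i \<in> Domain C. v dvd line_sum C f i}"

text \<open>Modulo \<open>2 * int (card C) + 1\<close> the nonzero residues are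
  \<open>1, ..., card C\<close> and their negatives, each once; this is the condition on the
  multiset of \<open>\<plusminus>x\<close>, moved to the integers.\<close>

definition signed_labelling :: "'c set \<Rightarrow> ('c \<Rightarrow> int) \<Rightarrow> bool" where
  "signed_labelling C f \<longleftrightarrow> bij_betw (\<lambda>p. \<bar>f p\<bar>) C {1..int (card C)}"

lemma finite_zero_lines: "finite C \<Longrightarrow> finite (zero_lines v C f)"
  by (simp add: zero_lines_def finite_Domain)

lemma line_sum_upd:
  assumes "finite C" "p \<in> C"
  shows "line_sum C (f(p := x)) i = line_sum C f i + (if i = fst p then x - f p else 0)"
proof (cases "i = fst p")
  case True
  then have p: "p = (i, snd p)" and mem: "snd p \<in> C `` {i}"
    using assms(2) by auto
  have fin: "finite (C `` {i})"
    using assms(1) by simp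
  have "(\<Sum>j \<in> C `` {i} - {snd p}. (f(p := x)) (i, j)) = (\<Sum>j \<in> C `` {i} - {snd p}. f (i, j))"
    by (rule sum.cong) (auto simp: prod_eq_iff)
  moreover have "(f(p := x)) (i, snd p) = x" "f (i, snd p) = f p"
    using p by (metis fun_upd_same, metis)
  ultimately show ?thesis
    unfolding line_sum_def sum.remove[OF fin mem] using True by simp
next
  case False
  then show ?thesis
    unfolding line_sum_def by (auto intro!: sum.cong)
qed

section \<open>Labellings under transposition, sign change and exchange\<close>

lemma comp_swap_upd: "f(p := x) \<circ> prod.swap = (f \<circ> prod.swap)(prod.swap p := x)"
  by (cases p) (auto simp: fun_eq_iff)

lemma swap_mem_converse: "p \<in> C \<Longrightarrow> prod.swap p \<in> C\<inverse>"
  by (cases p) simp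

lemma signed_labelling_flip:
  assumes "signed_labelling C f"
  shows "signed_labelling C (f(p := - f p))"
proof -
  have "(\<lambda>q. \<bar>(f(p := - f p)) q\<bar>) = (\<lambda>q. \<bar>f q\<bar>)"
    by auto
  then show ?thesis
    using assms by (simp add: signed_labelling_def)
qed

text \<open>Up to signs the update composes \<open>f\<close> with the transposition of
  \<open>p\<close> and \<open>q\<close>, a permutation of \<open>C\<close>.\<close>

lemma signed_labelling_swap:
  assumes "signed_labelling C f" "p \<in> C" "q \<in> C"
  shows "signed_labelling C (f(p := - f q, q := f p))"
proof -
  have "(\<lambda>c. \<bar>(f(p := - f q, q := f p)) c\<bar>) = (\<lambda>c. \<bar>f c\<bar>) \<circ> transpose p q"
    by (auto simp: fun_eq_iff transpose_def)
  moreover have "bij_betw (transpose p q) C C"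
    using assms(2,3) by (simp add: bij_betw_transpose_iff)
  ultimately show ?thesis
    using bij_betw_trans assms(1) unfolding signed_labelling_def by fastforce
qed

lemma signed_labelling_converse:
  assumes "signed_labelling C f"
  shows "signed_labelling (C\<inverse>) (f \<circ> prod.swap)"
proof -
  have swap: "bij_betw prod.swap (C\<inverse>) C"
    by (rule bij_betwI[where g = prod.swap]) auto
  have "card (C\<inverse>) = card C"
    by (rule bij_betw_same_card[OF swap])
  then show ?thesis
    using bij_betw_trans[OF swap assms[unfolded signed_labelling_def]]
    by (simp add: signed_labelling_def comp_def)
qed

section \<open>Divisibility of entries by the odd modulus\<close>

context
  fixes C :: "'c set" and f :: "'c \<Rightarrow> int" and v :: int
  assumes label: "signed_labelling C f" and v: "v = 2 * int (card C) + 1"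
begin

lemma signed_labelling_bounds: "p \<in> C \<Longrightarrow> 1 \<le> \<bar>f p\<bar> \<and> \<bar>f p\<bar> \<le> int (card C)"
  using label unfolding signed_labelling_def bij_betw_def by fastforce

lemma signed_labelling_not_dvd: "p \<in> C \<Longrightarrow> \<not> v dvd f p"
  using signed_labelling_bounds[of p] dvd_imp_le_int[of "f p" v] v by linarith

lemma signed_labelling_not_dvd_double: "p \<in> C \<Longrightarrow> \<not> v dvd 2 * f p"
proof -
  have "coprime v 2"
    using v by simp
  then show "p \<in> C \<Longrightarrow> \<not> v dvd 2 * f p"
    using signed_labelling_not_dvd by (simp add: coprime_dvd_mult_right_iff)
qed

text \<open>Distinct cells carry distinct absolute values, so both numbers are nonzero; their
  absolute values are at most \<open>2 * card C\<close>, which is less than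
  \<open>v\<close>.\<close>

lemma signed_labelling_not_dvd_pm:
  assumes "p \<in> C" "q \<in> C" "p \<noteq> q"
  shows "\<not> v dvd f p + f q" "\<not> v dvd f p - f q"
proof -
  have "\<bar>f p\<bar> \<noteq> \<bar>f q\<bar>"
    using label assms unfolding signed_labelling_def bij_betw_def by (auto dest: inj_onD)
  then show "\<not> v dvd f p + f q" "\<not> v dvd f p - f q"
    using signed_labelling_bounds[OF assms(1)] signed_labelling_bounds[OF assms(2)]
      dvd_imp_le_int[of "f p + f q" v] dvd_imp_le_int[of "f p - f q" v] v
    by linarith+
qed

end

text \<open>The inclusions say that no line becomes zero-sum while at least one row is repaired.
  Applied to \<open>C\<inverse>\<close>, the same statement repairs columns.\<close>

lemma repair_zero_line:
  assumes C: "finite C" and label: "signed_labelling C f" and v: "v = 2 * int (card C) + 1"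
    and r: "r \<in> zero_lines v C f"
  obtains g where "signed_labelling C g" "zero_lines v C g \<subset> zero_lines v C f"
    "zero_lines v (C\<inverse>) (g \<circ> prod.swap) \<subseteq> zero_lines v (C\<inverse>) (f \<circ> prod.swap)"
proof -
  note not_dvd = signed_labelling_not_dvd[OF label v] signed_labelling_not_dvd_double[OF label v]
    signed_labelling_not_dvd_pm[OF label v]
  define col where "col c = line_sum (C\<inverse>) (f \<circ> prod.swap) c" for c
  have C': "finite (C\<inverse>)"
    using C by simp
  have zero: "v dvd line_sum C f r" and "r \<in> Domain C"
    using r by (auto simp: zero_lines_def)
  then obtain c where c: "(r, c) \<in> C"
    by blast
  have "\<exists>d. (r, d) \<in> C \<and> d \<noteq> c"
  proof (rule ccontr)
    assume "\<not> ?thesis"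
    then have "C `` {r} = {c}"
      using c by blast
    then show False
      using zero not_dvd(1)[OF c] by (simp add: line_sum_def)
  qed
  then obtain d where d: "(r, d) \<in> C" and "d \<noteq> c"
    by blast
  then have cd: "c \<noteq> d"
    by simp
  show thesis
  proof (cases "\<exists>e. (r, e) \<in> C \<and> \<not> v dvd col e - 2 * f (r, e)")
    case True
    then obtain e where e: "(r, e) \<in> C" and ne: "\<not> v dvd col e - 2 * f (r, e)"
      by blast
    define g where "g = f((r, e) := - f (r, e))"
    have row: "line_sum C g i = line_sum C f i + (if i = r then - 2 * f (r, e) else 0)" for i
      unfolding g_def line_sum_upd[OF C e] by simp
    have "line_sum (C\<inverse>) (g \<circ> prod.swap) j = col j + (if j = e then - 2 * f (r, e) else 0)" for j
      unfolding g_def comp_swap_upd line_sum_upd[OF C' swap_mem_converse[OF e]] col_def by simp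
    then have "zero_lines v (C\<inverse>) (g \<circ> prod.swap) \<subseteq> zero_lines v (C\<inverse>) (f \<circ> prod.swap)"
      using ne by (auto simp: zero_lines_def col_def split: if_splits)
    moreover have "\<not> v dvd line_sum C g r"
      using not_dvd(2)[OF e] zero by (simp add: row dvd_diff_right_iff)
    then have "zero_lines v C g \<subset> zero_lines v C f"
      using r row by (auto simp: zero_lines_def split: if_splits)
    ultimately show thesis
      using that signed_labelling_flip[OF label] unfolding g_def by blast
  next
    case False
    define x where "x = f (r, c)"
    define y where "y = f (r, d)"
    \<comment> \<open>A plain exchange would leave the sum of row \<open>r\<close> at zero; the
      minus sign changes it by \<open>- 2 * y\<close>.\<close>
    define g where "g = f((r, c) := - y, (r, d) := x)"
    have stuck: "v dvd col c - 2 * x" "v dvd col d - 2 * y"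
      using False c d by (auto simp: x_def y_def)
    have ne: "\<not> v dvd 2 * y" "\<not> v dvd x - y" "\<not> v dvd x + y"
      using not_dvd(2)[OF d] not_dvd(3,4)[OF c d] cd by (auto simp: x_def y_def)
    have row: "line_sum C g i = line_sum C f i + (if i = r then - (2 * y) else 0)" for i
      unfolding g_def line_sum_upd[OF C d] line_sum_upd[OF C c] using cd
      by (simp add: x_def y_def)
    have colg: "line_sum (C\<inverse>) (g \<circ> prod.swap) j =
        col j + (if j = c then - y - x else 0) + (if j = d then x - y else 0)" for j
      unfolding g_def comp_swap_upd line_sum_upd[OF C' swap_mem_converse[OF d]]
        line_sum_upd[OF C' swap_mem_converse[OF c]] col_def
      using cd by (simp add: x_def y_def)
    have "\<not> v dvd line_sum (C\<inverse>) (g \<circ> prod.swap) c"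
    proof
      assume "v dvd line_sum (C\<inverse>) (g \<circ> prod.swap) c"
      \<comment> \<open>The new sum is \<open>col c - y - x\<close>; subtracting
        \<open>col c - 2 * x\<close> leaves \<open>x - y\<close>. For column \<open>d\<close> the
        same computation leaves \<open>x + y\<close>.\<close>
      from dvd_diff[OF this stuck(1)] show False
        using ne(2) cd by (simp add: colg)
    qed
    moreover have "\<not> v dvd line_sum (C\<inverse>) (g \<circ> prod.swap) d"
    proof
      assume "v dvd line_sum (C\<inverse>) (g \<circ> prod.swap) d"
      from dvd_diff[OF this stuck(2)] show False
        using ne(3) cd by (simp add: colg add.commute)
    qed
    ultimately have "zero_lines v (C\<inverse>) (g \<circ> prod.swap) \<subseteq> zero_lines v (C\<inverse>) (f \<circ> prod.swap)"
      unfolding zero_lines_def using colg col_def by auto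
    moreover have "\<not> v dvd line_sum C g r"
      using ne(1) zero by (simp add: row dvd_diff_right_iff)
    then have "zero_lines v C g \<subset> zero_lines v C f"
      using r row by (auto simp: zero_lines_def split: if_splits)
    ultimately show thesis
      using that signed_labelling_swap[OF label c d] unfolding g_def x_def y_def by blast
  qed
qed

section \<open>Minimising the number of zero-sum lines\<close>

lemma ex_signed_labelling:
  assumes "finite C"
  shows "\<exists>f. signed_labelling C f"
proof -
  have "card C = card {1..int (card C)}"
    by simp
  then obtain h where h: "bij_betw h C {1..int (card C)}"
    using assms finite_same_card_bij by blast
  moreover have "\<bar>h p\<bar> = h p" if "p \<in> C" for p
    using bij_betwE[OF h] that by fastforce
  ultimately show ?thesis
    unfolding signed_labelling_def by (metis (no_types, lifting) bij_betw_cong)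
qed

theorem ex_labelling_without_zero_lines:
  fixes C :: "('a \<times> 'b) set"
  assumes C: "finite C" and v: "v = 2 * int (card C) + 1"
  obtains f where "signed_labelling C f" "zero_lines v C f = {}"
    "zero_lines v (C\<inverse>) (f \<circ> prod.swap) = {}"
proof -
  define \<mu> where
    "\<mu> f = card (zero_lines v C f) + card (zero_lines v (C\<inverse>) (f \<circ> prod.swap))" for f
  obtain f where f: "signed_labelling C f" and min: "\<And>g. signed_labelling C g \<Longrightarrow> \<mu> f \<le> \<mu> g"
    using ex_has_least_nat[of "signed_labelling C" _ \<mu>] ex_signed_labelling[OF C] by blast
  have C': "finite (C\<inverse>)"
    using C by simp
  have "zero_lines v C f = {}"
  proof (rule ccontr)
    assume "zero_lines v C f \<noteq> {}"
    then obtain g where "signed_labelling C g" "zero_lines v C g \<subset> zero_lines v C f"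
      "zero_lines v (C\<inverse>) (g \<circ> prod.swap) \<subseteq> zero_lines v (C\<inverse>) (f \<circ> prod.swap)"
      using repair_zero_line[OF C f v] by blast
    then have "\<mu> g < \<mu> f" "\<mu> f \<le> \<mu> g"
      using min unfolding \<mu>_def
      by (auto intro!: add_less_le_mono psubset_card_mono card_mono
          finite_zero_lines C C' simp del: finite_converse)
    then show False
      by simp
  qed
  moreover have "zero_lines v (C\<inverse>) (f \<circ> prod.swap) = {}"
  proof (rule ccontr)
    \<comment> \<open>A zero-sum column is a zero-sum row of \<open>C\<inverse>\<close>. The
      repaired labelling \<open>h\<close> of \<open>C\<inverse>\<close> is brought back to
      \<open>C\<close> by a second swap, and the two terms of \<open>\<mu>\<close> exchange
      roles.\<close>
    have v': "v = 2 * int (card (C\<inverse>)) + 1"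
      using v by simp
    assume "zero_lines v (C\<inverse>) (f \<circ> prod.swap) \<noteq> {}"
    then obtain h where h: "signed_labelling (C\<inverse>) h"
      "zero_lines v (C\<inverse>) h \<subset> zero_lines v (C\<inverse>) (f \<circ> prod.swap)"
      "zero_lines v C (h \<circ> prod.swap) \<subseteq> zero_lines v C f"
      using repair_zero_line[OF C' signed_labelling_converse[OF f] v']
      by (auto simp: comp_assoc)
    have "signed_labelling C (h \<circ> prod.swap)"
      using signed_labelling_converse[OF h(1)] by simp
    moreover have "(h \<circ> prod.swap) \<circ> prod.swap = h"
      by (simp add: comp_assoc)
    ultimately have "\<mu> (h \<circ> prod.swap) < \<mu> f" "\<mu> f \<le> \<mu> (h \<circ> prod.swap)"
      using h min[of "h \<circ> prod.swap"] unfolding \<mu>_def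
      by (simp_all only: add_le_less_mono psubset_card_mono card_mono finite_zero_lines C C')
    then show False
      by simp
  qed
  ultimately show thesis
    using that f by blast
qed

section \<open>Non-zero sum Heffter arrays\<close>

text \<open>Adding \<open>i\<close> modulo \<open>n\<close> permutes \<open>{..<n}\<close>, so each
  of the \<open>k\<close> residues below \<open>k\<close> is hit once. This gives the line counts of
  the cyclic pattern of cells.\<close>

lemma card_add_mod_less:
  fixes n k i :: nat
  assumes "k \<le> n"
  shows "card {j. j < n \<and> (i + j) mod n < k} = k"
proof -
  let ?h = "\<lambda>j. (i + j) mod n"
  have inj: "inj_on ?h {..<n}"
  proof (rule inj_onI)
    fix a b assume "a \<in> {..<n}" "b \<in> {..<n}" "?h a = ?h b"
    then have "[i + a = i + b] (mod n)" "a < n" "b < n"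
      by (auto simp: cong_def)
    then show "a = b"
      by (simp add: cong_add_lcancel_nat cong_less_modulus_unique_nat)
  qed
  moreover have "?h ` {..<n} \<subseteq> {..<n}"
    by (cases "n = 0") auto
  ultimately have surj: "?h ` {..<n} = {..<n}"
    by (intro endo_inj_surj) auto
  have "?h ` {j. j < n \<and> (i + j) mod n < k} = {..<k}"
  proof (intro equalityI subsetI)
    fix t assume "t \<in> {..<k}"
    moreover from this have "t \<in> ?h ` {..<n}"
      using surj assms by auto
    ultimately show "t \<in> ?h ` {j. j < n \<and> (i + j) mod n < k}"
      by auto
  qed auto
  moreover have "inj_on ?h {j. j < n \<and> (i + j) mod n < k}"
    using inj by (rule inj_on_subset) auto
  ultimately show ?thesis
    by (metis card_image card_lessThan)
qed

section \<open>From integer labellings to the residue ring\<close>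

lemma (in residues) finsum_mod:
  "finite S \<Longrightarrow> (\<Oplus>s \<in> S. h s mod m) = (\<Sum>s \<in> S. h s) mod m"
proof (induction S rule: finite_induct)
  case empty
  then show ?case
    by (simp add: zero_cong)
next
  case (insert s S)
  then show ?case
    by (simp add: Pi_def add_cong)
qed

text \<open>The residues of \<open>z\<close> and \<open>- z\<close> are
  \<open>\<bar>z\<bar>\<close>, in the lower half \<open>1..N\<close>, and
  \<open>v - \<bar>z\<bar>\<close>, in the upper half. So \<open>x\<close> occurs at most once, and
  the half containing \<open>x\<close> decides which of the two it must equal.\<close>

lemma count_pm_mod:
  fixes z x v N :: int
  assumes "v = 2 * N + 1" "1 \<le> \<bar>z\<bar>" "\<bar>z\<bar> \<le> N" "1 \<le> x" "x < v"
  shows "count {# z mod v, (- z) mod v #} x =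
    (if \<bar>z\<bar> = (if x \<le> N then x else v - x) then 1 else 0)"
proof (cases "z > 0")
  case True
  have "z mod v = z"
    using assms True by (intro mod_pos_pos_trivial) auto
  moreover have "(- z) mod v = v - z"
    using assms True by (simp add: zmod_zminus1_eq_if)
  ultimately show ?thesis
    using assms True by auto
next
  case False
  have "(- z) mod v = - z"
    using assms False by (intro mod_pos_pos_trivial) auto
  moreover have "z mod v = v + z"
    using assms False zmod_zminus1_eq_if[of "- z" v] by auto
  ultimately show ?thesis
    using assms False by auto
qed

lemma nonzero_sum_Heffter_of_labelling:
  fixes C :: "(nat \<times> nat) set"
  assumes C: "C \<subseteq> {..<n} \<times> {..<n}" and card: "card C = n * k" and pos: "0 < n" "0 < k"
    and rows: "\<And>i. i < n \<Longrightarrow> card (C `` {i}) = k"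
    and cols: "\<And>j. j < n \<Longrightarrow> card (C\<inverse> `` {j}) = k"
    and v: "v = 2 * int (card C) + 1"
    and f: "signed_labelling C f" "zero_lines v C f = {}"
      "zero_lines v (C\<inverse>) (f \<circ> prod.swap) = {}"
  shows "nonzero_sum_Heffter n k (\<lambda>i j. if (i, j) \<in> C then Some (f (i, j) mod v) else None)"
    (is "nonzero_sum_Heffter n k ?A")
proof -
  have v': "int (2 * n * k + 1) = v"
    using v card by simp
  \<comment> \<open>The locale \<open>residues\<close> asks for a modulus above 1, so there must be
    at least one cell.\<close>
  have N: "int (card C) \<ge> 1"
    using pos card nat_0_less_mult_iff[of n k] by linarith
  have fin: "finite C"
    using C finite_subset by blast
  interpret residues v "residue_ring v"
    by unfold_locales (use v N in auto)
  have carrier: "carrier (residue_ring v) = {0..v - 1}"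
    by (simp add: residue_ring_def)
  have rs: "row_support ?A i = C `` {i}" for i
    by (auto simp: row_support_def)
  have cs: "col_support ?A j = C\<inverse> `` {j}" for j
    by (auto simp: col_support_def)
  \<comment> \<open>As \<open>zero_lines\<close> sees only lines with a cell, each row and column
    must be shown to have one; \<open>0 < k\<close> provides it.\<close>
  have Domain: "x \<in> Domain D" if "card (D `` {x}) = k" for x and D :: "(nat \<times> nat) set"
  proof -
    have "D `` {x} \<noteq> {}"
      using that pos by auto
    then show ?thesis
      by blast
  qed
  have "row_sum (residue_ring v) ?A i = line_sum C f i mod v" for i
  proof -
    have "row_sum (residue_ring v) ?A i =
        (\<Oplus>\<^bsub>residue_ring v\<^esub>j \<in> C `` {i}. f (i, j) mod v)"
      unfolding row_sum_def rs by (rule finsum_cong') (auto simp: mod_in_carrier)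
    then show ?thesis
      using fin by (simp add: finsum_mod line_sum_def finite_Image)
  qed
  then have row_nz: "row_sum (residue_ring v) ?A i \<noteq> \<zero>\<^bsub>residue_ring v\<^esub>"
    if "i < n" for i
    using f(2) Domain[OF rows[OF that]] by (auto simp: zero_lines_def res_zero_eq dvd_eq_mod_eq_0)
  have "col_sum (residue_ring v) ?A j = line_sum (C\<inverse>) (f \<circ> prod.swap) j mod v" for j
  proof -
    have "col_sum (residue_ring v) ?A j =
        (\<Oplus>\<^bsub>residue_ring v\<^esub>i \<in> C\<inverse> `` {j}. f (i, j) mod v)"
      unfolding col_sum_def cs by (rule finsum_cong') (auto simp: mod_in_carrier)
    then show ?thesis
      using fin by (simp add: finsum_mod line_sum_def finite_Image)
  qed
  then have col_nz: "col_sum (residue_ring v) ?A j \<noteq> \<zero>\<^bsub>residue_ring v\<^esub>"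
    if "j < n" for j
    using f(3) Domain[OF cols[OF that]] by (auto simp: zero_lines_def res_zero_eq dvd_eq_mod_eq_0)
  have pm: "pm_mset (residue_ring v) ?A = (\<Sum>p \<in> C. {# f p mod v, (- f p) mod v #})"
    unfolding pm_mset_def by (rule sum.cong) (auto simp: filled_cells_def res_neg_eq mod_minus_eq)
  have "count (pm_mset (residue_ring v) ?A) x = 1" if "1 \<le> x" "x < v" for x
  proof -
    \<comment> \<open>Of \<open>x\<close> and \<open>v - x\<close>, exactly one lies in
      \<open>1..card C\<close>; the bijection assigns it to a single cell \<open>p\<close>, the only
      one contributing to the count.\<close>
    define y where "y = (if x \<le> int (card C) then x else v - x)"
    have "y \<in> {1..int (card C)}"
      using that v by (auto simp: y_def)
    then obtain p where p: "p \<in> C" "\<bar>f p\<bar> = y"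
      using f(1) unfolding signed_labelling_def bij_betw_def by (metis (no_types, lifting) imageE)
    have "count {# f q mod v, (- f q) mod v #} x = (if q = p then 1 else 0)" if "q \<in> C" for q
    proof -
      have "\<bar>f q\<bar> = y \<longleftrightarrow> q = p"
        using f(1) p that unfolding signed_labelling_def bij_betw_def by (auto dest: inj_onD)
      then show ?thesis
        using count_pm_mod[OF v, of "f q" x] signed_labelling_bounds[OF f(1) v that]
          \<open>1 \<le> x\<close> \<open>x < v\<close>
        by (simp add: y_def)
    qed
    then show ?thesis
      unfolding pm count_sum using p(1) fin by (simp add: sum.delta)
  qed
  moreover have "pf_array n n {0..v - 1} ?A"
    using C mod_in_carrier unfolding carrier by (auto simp: pf_array_def split: if_splits)
  ultimately show ?thesis
    unfolding nonzero_sum_Heffter_def Let_def v' carrier rs cs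
    using rows cols row_nz col_nz by (auto simp: res_zero_eq)
qed

theorem corollary3p5:
  fixes n k :: nat
  assumes "n \<ge> k" and "k \<ge> 1"
  shows "\<exists>A. nonzero_sum_Heffter n k A"
proof -
  \<comment> \<open>These are \<open>k\<close> consecutive cyclic antidiagonals. The symmetry in
    \<open>i\<close> and \<open>j\<close> gives \<open>C\<inverse> = C\<close>, so the row counts
    serve for the columns too.\<close>
  define C where "C = {(i, j). i < n \<and> j < n \<and> (i + j) mod n < k}"
  have sub: "C \<subseteq> {..<n} \<times> {..<n}"
    by (auto simp: C_def)
  have row: "C `` {i} = {j. j < n \<and> (i + j) mod n < k}" if "i < n" for i
    using that by (auto simp: C_def)
  have "C\<inverse> = C"
    by (auto simp: C_def add.commute)
  moreover have rows: "card (C `` {i}) = k" if "i < n" for i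
    using row[OF that] card_add_mod_less[OF assms(1)] by simp
  moreover have "card C = n * k"
  proof -
    have "C = (SIGMA i:{..<n}. C `` {i})"
      using sub by auto
    then have "card C = (\<Sum>i<n. card (C `` {i}))"
      using card_SigmaI[of "{..<n}" "\<lambda>i. C `` {i}"] finite_subset[OF sub]
      by simp
    then show ?thesis
      using rows by simp
  qed
  moreover obtain f where "signed_labelling C f" "zero_lines (2 * int (card C) + 1) C f = {}"
    "zero_lines (2 * int (card C) + 1) (C\<inverse>) (f \<circ> prod.swap) = {}"
    using ex_labelling_without_zero_lines[OF finite_subset[OF sub]] by auto
  ultimately show ?thesis
    using nonzero_sum_Heffter_of_labelling[OF sub, where k = k and f = f] assms by fastforce
qed

end
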